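(* Let $n\ge 1$. For every integer $0\le k\le 2^{n-1}$, $$(2k+1)\,\theta(n,k)\ge 2\sum_{i=0}^{k}\theta(n,i).$$
   Context: For $S\subset\{0,1\}^n$, $\theta(n,S)$ is the number of edges of the hypercube $Q_n$ (vertices $\{0,1\}^n$, adjacent iff differing in one coordinate) with exactly one endpoint in $S$; $\theta(n,k)=\min\{\theta(n,S): |S|=k\}$. *)

theory Defs
  imports Main
begin

definition cube_vertices :: "nat \<Rightarrow> bool list set" where
  "cube_vertices n = {v. length v = n}"

definition cube_adj :: "nat \<Rightarrow> bool list \<Rightarrow> bool list \<Rightarrow> bool" where
  "cube_adj n u v \<longleftrightarrow> u \<in> cube_vertices n \<and> v \<in> cube_vertices n \<and> card {i. i < n \<and> u ! i \<noteq> v ! i} = 1"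

definition cube_edges :: "nat \<Rightarrow> bool list set set" where
  "cube_edges n = {{u, v} | u v. cube_adj n u v}"

definition theta_set :: "nat \<Rightarrow> bool list set \<Rightarrow> nat" where
  "theta_set n S = card {e \<in> cube_edges n. card (e \<inter> S) = 1}"

(* The set under Min is finite, and it is nonempty exactly when k \<le> 2 ^ n. *)
definition theta :: "nat \<Rightarrow> nat \<Rightarrow> nat" where
  "theta n k = Min {theta_set n S | S. S \<subseteq> cube_vertices n \<and> card S = k}"

lemma finite_cube_vertices: "finite (cube_vertices n)"
  using finite_lists_length_eq[of "UNIV :: bool set" n] by (simp add: cube_vertices_def)

lemma card_cube_vertices: "card (cube_vertices n) = 2 ^ n"
  using card_lists_length_eq[of "UNIV :: bool set" n] by (simp add: cube_vertices_def)

lemma finite_theta_candidates: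
  "finite {theta_set n S | S. S \<subseteq> cube_vertices n \<and> card S = k}"
proof -
  have "{theta_set n S | S. S \<subseteq> cube_vertices n \<and> card S = k}
      \<subseteq> theta_set n ` Pow (cube_vertices n)"
    by auto
  then show ?thesis
    by (rule finite_subset) (simp add: finite_cube_vertices)
qed

lemma theta_candidates_nonempty:
  "{theta_set n S | S. S \<subseteq> cube_vertices n \<and> card S = k} \<noteq> {} \<longleftrightarrow> k \<le> 2 ^ n"
proof
  assume "{theta_set n S | S. S \<subseteq> cube_vertices n \<and> card S = k} \<noteq> {}"
  then show "k \<le> 2 ^ n"
    using card_mono[OF finite_cube_vertices[of n]] by (auto simp: card_cube_vertices)
next
  assume "k \<le> 2 ^ n"
  then obtain S where "S \<subseteq> cube_vertices n" "card S = k"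
    using obtain_subset_with_card_n[of k "cube_vertices n"] by (auto simp: card_cube_vertices)
  then show "{theta_set n S | S. S \<subseteq> cube_vertices n \<and> card S = k} \<noteq> {}"
    by blast
qed

end

theory Submission
  imports Defs
begin

text \<open>
  By the edge-isoperimetric theorem of Harper, initial segments of the binary order are optimal, so
  \<open>theta n k = n k - 2 f k\<close> with \<open>f k = (\<Sum>j<k. s j)\<close> and \<open>s\<close> the binary digit sum.
  Summation by parts then turns the claim into \<open>2 (\<Sum>j<k. (2 j + 1) s j) \<le> n k\<^sup>2\<close>, which follows by
  induction on \<open>n\<close>, writing \<open>k = 2\<^sup>m + r\<close> and removing the leading binary digit.
\<close>

section \<open>Partial sums of the binary digit sum\<close>

fun digit_sum :: "nat \<Rightarrow> nat" where
  "digit_sum n = (if n = 0 then 0 else n mod 2 + digit_sum (n div 2))"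

declare digit_sum.simps [simp del]

lemma digit_sum_0 [simp]: "digit_sum 0 = 0"
  by (simp add: digit_sum.simps)

lemma digit_sum_double [simp]: "digit_sum (2 * n) = digit_sum n"
  by (cases "n = 0") (simp_all add: digit_sum.simps[of "2 * n"])

lemma digit_sum_Suc_double [simp]: "digit_sum (Suc (2 * n)) = Suc (digit_sum n)"
  by (simp add: digit_sum.simps[of "Suc (2 * n)"])

text \<open>The power contributes one new digit above all digits of \<open>r\<close>. The induction
  strips the lowest digit, following the recursion of \<open>digit_sum\<close>.\<close>

lemma digit_sum_power2_add: "r < 2 ^ m \<Longrightarrow> digit_sum (2 ^ m + r) = Suc (digit_sum r)"
proof (induction m arbitrary: r)
  case 0
  then show ?case
    using digit_sum_Suc_double[of 0] by simp
next
  case (Suc m)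
  show ?case
  proof (cases "even r")
    case True
    then obtain q where q: "r = 2 * q" by blast
    then have "digit_sum (2 ^ m + q) = Suc (digit_sum q)"
      using Suc by simp
    moreover have "2 ^ Suc m + r = 2 * (2 ^ m + q)"
      using q by simp
    ultimately show ?thesis
      using q by (metis digit_sum_double)
  next
    case False
    then obtain q where q: "r = Suc (2 * q)" by (auto elim: oddE)
    then have "digit_sum (2 ^ m + q) = Suc (digit_sum q)"
      using Suc by simp
    moreover have "2 ^ Suc m + r = Suc (2 * (2 ^ m + q))"
      using q by simp
    ultimately show ?thesis
      using q by (metis digit_sum_Suc_double)
  qed
qed

text \<open>Geometrically this is the largest number of edges of a cube spanned by \<open>k\<close>
  of its vertices, as the isoperimetric bounds below show.\<close>

definition digit_sum_upto :: "nat \<Rightarrow> nat" where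
  "digit_sum_upto k = (\<Sum>j<k. digit_sum j)"

lemma digit_sum_upto_0 [simp]: "digit_sum_upto 0 = 0"
  by (simp add: digit_sum_upto_def)

lemma digit_sum_upto_Suc: "digit_sum_upto (Suc k) = digit_sum_upto k + digit_sum k"
  by (simp add: digit_sum_upto_def)

lemma digit_sum_upto_double: "digit_sum_upto (2 * k) = 2 * digit_sum_upto k + k"
  by (induction k) (simp_all add: digit_sum_upto_Suc)

lemma digit_sum_upto_Suc_double:
  "digit_sum_upto (Suc (2 * k)) = digit_sum_upto k + digit_sum_upto (Suc k) + k"
  by (simp add: digit_sum_upto_Suc digit_sum_upto_double)

text \<open>Of the numbers below \<open>k\<close>, \<open>Suc k div 2\<close> are even and
  \<open>k div 2\<close> are odd; dropping the last digit turns each class into an initial interval,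
  and each odd number loses one. The recursion of \<open>initial_segment\<close> makes the same
  split.\<close>

lemma digit_sum_upto_halves:
  "digit_sum_upto k = digit_sum_upto (Suc k div 2) + digit_sum_upto (k div 2) + k div 2"
proof (cases "even k")
  case True
  then show ?thesis
    by (auto elim!: evenE simp: digit_sum_upto_double)
next
  case False
  then show ?thesis
    by (auto elim!: oddE simp: digit_sum_upto_Suc_double)
qed

text \<open>The numerical core of the isoperimetric bound: sets of sizes \<open>a\<close> and
  \<open>b\<close> in opposite facets are joined by at most \<open>b\<close> edges. Halving both
  arguments according to their parities reduces the claim to smaller sums.\<close>

lemma digit_sum_upto_superadditive:
  "b \<le> a \<Longrightarrow> digit_sum_upto a + digit_sum_upto b + b \<le> digit_sum_upto (a + b)"
proof (induction "a + b" arbitrary: a b rule: less_induct)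
  case less
  let ?f = digit_sum_upto
  show ?case
  proof (cases "b = 0")
    case True
    then show ?thesis by simp
  next
    case False
    \<comment> \<open>The sum has to drop strictly; in the cases \<open>ee\<close> and
      \<open>oe\<close> this relies on \<open>b \<noteq> 0\<close>.\<close>
    have ind: "?f x + ?f y + y \<le> ?f (x + y)" if "x + y < a + b" "y \<le> x" for x y
      using less.hyps that by blast
    consider (ee) p q where "a = 2 * p" "b = 2 * q" | (eo) p q where "a = 2 * p" "b = Suc (2 * q)"
      | (oe) p q where "a = Suc (2 * p)" "b = 2 * q"
      | (oo) p q where "a = Suc (2 * p)" "b = Suc (2 * q)"
      by (cases "even a"; cases "even b") (auto elim!: evenE oddE)
    then show ?thesis
    proof cases
      case ee
      have "?f (a + b) = 2 * ?f (p + q) + (p + q)"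
        using ee digit_sum_upto_double[of "p + q"] by simp
      moreover have "?f p + ?f q + q \<le> ?f (p + q)"
        by (rule ind) (use ee False less.prems in simp_all)
      ultimately show ?thesis
        using ee by (simp add: digit_sum_upto_double)
    next
      case eo
      have "?f (a + b) = ?f (p + q) + ?f (p + Suc q) + (p + q)"
        using eo digit_sum_upto_Suc_double[of "p + q"] by simp
      moreover have "?f p + ?f q + q \<le> ?f (p + q)" "?f p + ?f (Suc q) + Suc q \<le> ?f (p + Suc q)"
        by (rule ind; use eo less.prems in simp)+
      ultimately show ?thesis
        using eo by (simp add: digit_sum_upto_double digit_sum_upto_Suc_double)
    next
      case oe
      have "?f (a + b) = ?f (p + q) + ?f (Suc p + q) + (p + q)"
        using oe digit_sum_upto_Suc_double[of "p + q"] by simp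
      moreover have "?f p + ?f q + q \<le> ?f (p + q)" "?f (Suc p) + ?f q + q \<le> ?f (Suc p + q)"
        by (rule ind; use oe False less.prems in simp)+
      ultimately show ?thesis
        using oe by (simp add: digit_sum_upto_double digit_sum_upto_Suc_double)
    next
      case oo
      have "?f (a + b) = 2 * ?f (Suc (p + q)) + Suc (p + q)"
        using oo digit_sum_upto_double[of "Suc (p + q)"] by simp
      moreover have "?f (Suc p) + ?f q + q \<le> ?f (Suc p + q)"
        by (rule ind) (use oo less.prems in simp_all)
      \<comment> \<open>If \<open>p = q\<close>, the pair \<open>p\<close>, \<open>Suc q\<close> is
        in the wrong order, so the roles are swapped. The smaller is then \<open>p = q\<close>, and
        the summand \<open>q\<close> in place of \<open>Suc q\<close> still suffices.\<close>
      moreover have "?f p + ?f (Suc q) + q \<le> ?f (Suc (p + q))"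
      proof (cases "p = q")
        case True
        have "?f (Suc p) + ?f p + p \<le> ?f (Suc p + p)"
          by (rule ind) (use oo less.prems in simp_all)
        then show ?thesis
          using True by simp
      next
        case False
        have "?f p + ?f (Suc q) + Suc q \<le> ?f (p + Suc q)"
          by (rule ind) (use oo False less.prems in simp_all)
        then show ?thesis by simp
      qed
      ultimately show ?thesis
        using oo by (simp add: digit_sum_upto_Suc_double)
    qed
  qed
qed

lemma sum_lessThan_add:
  fixes g :: "nat \<Rightarrow> nat"
  shows "(\<Sum>j<a + r. g j) = (\<Sum>j<a. g j) + (\<Sum>j<r. g (a + j))"
  by (induction r) simp_all

text \<open>The block starting at \<open>2 ^ m\<close> repeats the digit sums from 0 on, each raised
  by the leading digit. The value \<open>r = 2 ^ m\<close> is allowed because only indices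
  \<open>j < r\<close> occur.\<close>

lemma digit_sum_upto_power2_add:
  assumes "r \<le> 2 ^ m"
  shows "digit_sum_upto (2 ^ m + r) = digit_sum_upto (2 ^ m) + digit_sum_upto r + r"
proof -
  have "(\<Sum>j<r. digit_sum (2 ^ m + j)) = (\<Sum>j<r. digit_sum j + 1)"
    by (rule sum.cong) (use assms in \<open>simp_all add: digit_sum_power2_add\<close>)
  also have "\<dots> = (\<Sum>j<r. digit_sum j) + r"
    unfolding sum.distrib by simp
  finally show ?thesis
    by (simp add: digit_sum_upto_def sum_lessThan_add)
qed

lemma le_power2_Suc_cases:
  fixes k m :: nat
  assumes "k \<le> 2 ^ Suc m"
  obtains "k \<le> 2 ^ m" | r where "k = 2 ^ m + r" "r \<le> 2 ^ m"
proof (cases "k \<le> 2 ^ m")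
  case False
  then show ?thesis
    using assms that(2)[of "k - 2 ^ m"] by simp
qed (rule that(1))

text \<open>In each of \<open>m\<close> binary positions at most half of the numbers below
  \<open>k\<close> have digit 1. In the induction the leading digit adds \<open>2 * r\<close>, which
  is at most \<open>2 ^ m + r\<close>.\<close>

lemma digit_sum_upto_le: "k \<le> 2 ^ m \<Longrightarrow> 2 * digit_sum_upto k \<le> m * k"
proof (induction m arbitrary: k)
  case 0
  then have "k = 0 \<or> k = Suc 0" by auto
  then show ?case
    by (auto simp: digit_sum_upto_Suc)
next
  case (Suc m)
  from Suc.prems show ?case
  proof (cases rule: le_power2_Suc_cases)
    case 1
    then show ?thesis
      using Suc.IH[of k] by simp
  next
    case (2 r)
    have "2 * digit_sum_upto (2 ^ m) \<le> m * 2 ^ m" "2 * digit_sum_upto r \<le> m * r"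
      using Suc.IH 2 by simp_all
    then show ?thesis
      using 2 digit_sum_upto_power2_add[OF 2(2)] by (simp add: distrib_left)
  qed
qed

section \<open>Weighted digit sums and their quadratic bound\<close>

text \<open>The weights are the increments of the squares, so they add up to \<open>k * k\<close>;
  they are the ones that summation by parts produces.\<close>

definition weighted_digit_sum_upto :: "nat \<Rightarrow> nat" where
  "weighted_digit_sum_upto k = (\<Sum>j<k. (2 * j + 1) * digit_sum j)"

lemma weighted_digit_sum_upto_summation_by_parts:
  "(2 * k + 1) * digit_sum_upto k = 2 * (\<Sum>i=0..k. digit_sum_upto i) + weighted_digit_sum_upto k"
  by (induction k) (simp_all add: weighted_digit_sum_upto_def digit_sum_upto_Suc algebra_simps)

text \<open>Put \<open>N = 2 ^ m\<close> and expand
  \<open>(2 * N + (2 * j + 1)) * (digit_sum j + 1)\<close>; the term \<open>r * r\<close> is the sum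
  of the first \<open>r\<close> odd numbers.\<close>

lemma weighted_digit_sum_upto_power2_add:
  assumes "r \<le> 2 ^ m"
  shows "weighted_digit_sum_upto (2 ^ m + r) = weighted_digit_sum_upto (2 ^ m)
    + weighted_digit_sum_upto r + 2 * 2 ^ m * digit_sum_upto r + r * r + 2 * 2 ^ m * r"
proof -
  have "(\<Sum>j<r. (2 * (2 ^ m + j) + 1) * digit_sum (2 ^ m + j))
      = (\<Sum>j<r. (2 * (2 ^ m + j) + 1) * Suc (digit_sum j))"
    by (rule sum.cong) (use assms in \<open>simp_all add: digit_sum_power2_add\<close>)
  also have "\<dots> = weighted_digit_sum_upto r + 2 * 2 ^ m * digit_sum_upto r + r * r + 2 * 2 ^ m * r"
    by (induction r)
      (simp_all add: weighted_digit_sum_upto_def digit_sum_upto_Suc algebra_simps)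
  finally show ?thesis
    by (simp add: weighted_digit_sum_upto_def sum_lessThan_add)
qed

text \<open>The final inequality uses this with \<open>m = n - 1\<close>, where the factor
  \<open>Suc m\<close> is the dimension. The induction removes the leading binary digit of
  \<open>k\<close>.\<close>

lemma weighted_digit_sum_upto_le: "k \<le> 2 ^ m \<Longrightarrow> 2 * weighted_digit_sum_upto k \<le> Suc m * (k * k)"
proof (induction m arbitrary: k)
  case 0
  then have "k = 0 \<or> k = Suc 0" by auto
  then show ?case
    by (auto simp: weighted_digit_sum_upto_def)
next
  case (Suc m)
  let ?W = weighted_digit_sum_upto
  from Suc.prems show ?case
  proof (cases rule: le_power2_Suc_cases)
    case 1
    then show ?thesis
      using Suc.IH[of k] by simp
  next
    case (2 r)
    define N :: nat where "N = 2 ^ m"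
    have "2 * ?W N \<le> Suc m * (N * N)" "2 * ?W r \<le> Suc m * (r * r)"
      using Suc.IH 2 by (simp_all add: N_def)
    \<comment> \<open>The unweighted bound, scaled by \<open>N\<close>, controls the mixed term of
      the expansion of \<open>?W k\<close>.\<close>
    moreover have "N * digit_sum_upto r * 2 \<le> N * (m * r)"
      using 2 digit_sum_upto_le[of r m] mult_le_mono2[of "2 * digit_sum_upto r" "m * r" N]
      by (simp only: ac_simps)
    \<comment> \<open>The multiples of \<open>N * r\<close> balance exactly; what remains is a
      surplus \<open>r * r\<close> to be covered by \<open>N * N\<close>.\<close>
    moreover have "r * r \<le> N * N"
      using 2 by (auto simp: N_def intro: mult_le_mono)
    moreover have "?W k = ?W N + ?W r + 2 * N * digit_sum_upto r + r * r + 2 * N * r"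
      using 2 weighted_digit_sum_upto_power2_add by (simp add: N_def)
    moreover have "Suc (Suc m) * (k * k) = Suc m * (N * N) + Suc m * (r * r) + N * N + r * r
        + 2 * (N * (m * r)) + 4 * (N * r)"
      using 2 by (simp add: N_def[symmetric] algebra_simps)
    ultimately show ?thesis
      by linarith
  qed
qed

section \<open>The edge-isoperimetric theorem in the cube\<close>

definition slice :: "bool \<Rightarrow> bool list set \<Rightarrow> bool list set" where
  "slice b S = {v. b # v \<in> S}"

definition glue :: "bool list set \<Rightarrow> bool list set \<Rightarrow> bool list set" where
  "glue A B = Cons False ` A \<union> Cons True ` B"

lemma glue_slices:
  assumes "S \<subseteq> cube_vertices (Suc n)"
  shows "glue (slice False S) (slice True S) = S"
proof
  show "S \<subseteq> glue (slice False S) (slice True S)"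
  proof
    fix v assume "v \<in> S"
    with assms obtain b w where "v = b # w"
      by (auto simp: cube_vertices_def length_Suc_conv)
    with \<open>v \<in> S\<close> show "v \<in> glue (slice False S) (slice True S)"
      by (cases b) (auto simp: glue_def slice_def)
  qed
qed (auto simp: glue_def slice_def)

lemma slice_subset: "S \<subseteq> cube_vertices (Suc n) \<Longrightarrow> slice b S \<subseteq> cube_vertices n"
  by (auto simp: slice_def cube_vertices_def)

lemma card_glue:
  assumes "finite A" "finite B"
  shows "card (glue A B) = card A + card B"
proof -
  have "card (glue A B) = card (Cons False ` A) + card (Cons True ` B)"
    unfolding glue_def by (rule card_Un_disjoint) (use assms in auto)
  then show ?thesis
    by (simp add: card_image)
qed

text \<open>The differing positions of the tails are shifted by \<open>Suc\<close>, and position 0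
  joins them when the heads differ. A total of one leaves either equal heads and adjacent tails, or
  different heads and equal tails.\<close>

lemma cube_adj_Suc:
  "cube_adj (Suc n) (a # u) (b # v) \<longleftrightarrow>
     a = b \<and> cube_adj n u v \<or> a \<noteq> b \<and> u = v \<and> u \<in> cube_vertices n"
proof (cases "length u = n \<and> length v = n")
  case True
  let ?D = "{i. i < n \<and> u ! i \<noteq> v ! i}"
  have "{i. i < Suc n \<and> (a # u) ! i \<noteq> (b # v) ! i} = (if a = b then {} else {0}) \<union> Suc ` ?D"
    by (auto simp: less_Suc_eq_0_disj)
  then have "card {i. i < Suc n \<and> (a # u) ! i \<noteq> (b # v) ! i} = (if a = b then 0 else 1) + card ?D"
    by (simp add: card_image card_insert_if image_iff)
  moreover have "card ?D = 0 \<longleftrightarrow> u = v"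
    using True by (auto simp: list_eq_iff_nth_eq)
  ultimately show ?thesis
    using True by (auto simp: cube_adj_def cube_vertices_def)
qed (auto simp: cube_adj_def cube_vertices_def)

text \<open>An edge either stays in one of the two facets or belongs to the perfect matching between
  them.\<close>

lemma cube_edges_Suc:
  "cube_edges (Suc n) = image (Cons False) ` cube_edges n \<union> image (Cons True) ` cube_edges n
     \<union> (\<lambda>v. {False # v, True # v}) ` cube_vertices n" (is "_ = ?A False \<union> ?A True \<union> ?C")
proof
  show "cube_edges (Suc n) \<subseteq> ?A False \<union> ?A True \<union> ?C"
  proof
    fix e assume "e \<in> cube_edges (Suc n)"
    then obtain u v where e: "e = {u, v}" "cube_adj (Suc n) u v"
      by (auto simp: cube_edges_def)
    then obtain a u' b v' where uv: "u = a # u'" "v = b # v'"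
      by (auto simp: cube_adj_def cube_vertices_def length_Suc_conv)
    show "e \<in> ?A False \<union> ?A True \<union> ?C"
    proof (cases "a = b")
      case True
      then have "e = Cons a ` {u', v'}" "{u', v'} \<in> cube_edges n"
        using e uv by (auto simp: cube_adj_Suc cube_edges_def)
      then have "e \<in> ?A a"
        by (rule image_eqI)
      then show ?thesis
        by (cases a) simp_all
    next
      case False
      then show ?thesis
        using e uv by (cases a; cases b) (auto simp: cube_adj_Suc)
    qed
  qed
  have "?A b \<subseteq> cube_edges (Suc n)" for b
  proof
    fix e assume "e \<in> ?A b"
    then obtain u v where "e = {b # u, b # v}" "cube_adj n u v"
      by (auto simp: cube_edges_def)
    then show "e \<in> cube_edges (Suc n)"
      using cube_adj_Suc[of n b u b v] by (auto simp: cube_edges_def)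
  qed
  moreover have "?C \<subseteq> cube_edges (Suc n)"
  proof
    fix e assume "e \<in> ?C"
    then obtain v where "e = {False # v, True # v}" "v \<in> cube_vertices n"
      by auto
    then show "e \<in> cube_edges (Suc n)"
      using cube_adj_Suc[of n False v True v] by (auto simp: cube_edges_def)
  qed
  ultimately show "?A False \<union> ?A True \<union> ?C \<subseteq> cube_edges (Suc n)"
    by blast
qed

lemma cube_edges_subset_Pow: "cube_edges n \<subseteq> Pow (cube_vertices n)"
  by (auto simp: cube_edges_def cube_adj_def)

lemma finite_cube_edges: "finite (cube_edges n)"
  using cube_edges_subset_Pow by (rule finite_subset) (simp add: finite_cube_vertices)

text \<open>Needed for disjointness: the empty set would have the same image in both facets.\<close>

lemma empty_notin_cube_edges: "{} \<notin> cube_edges n"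
  by (auto simp: cube_edges_def)

definition edge_boundary :: "nat \<Rightarrow> bool list set \<Rightarrow> bool list set set" where
  "edge_boundary n S = {e \<in> cube_edges n. card (e \<inter> S) = 1}"

text \<open>An edge inside a facet meets the glued set only in that facet's part, and the matching
  edge at \<open>v\<close> is cut exactly when \<open>v\<close> lies in one of \<open>A\<close>,
  \<open>B\<close> but not in both.\<close>

lemma edge_boundary_glue:
  assumes "A \<subseteq> cube_vertices n" "B \<subseteq> cube_vertices n"
  shows "edge_boundary (Suc n) (glue A B) =
    image (Cons False) ` edge_boundary n A \<union> image (Cons True) ` edge_boundary n B
      \<union> (\<lambda>v. {False # v, True # v}) ` ((A - B) \<union> (B - A))"
proof -
  have F: "Cons False ` e \<inter> glue A B = Cons False ` (e \<inter> A)"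
    and T: "Cons True ` e \<inter> glue A B = Cons True ` (e \<inter> B)" for e
    by (auto simp: glue_def)
  have V: "card ({False # v, True # v} \<inter> glue A B) = 1 \<longleftrightarrow> v \<in> (A - B) \<union> (B - A)" for v
  proof -
    have "{False # v, True # v} \<inter> glue A B
        = (if v \<in> A then {False # v} else {}) \<union> (if v \<in> B then {True # v} else {})"
      by (auto simp: glue_def)
    then show ?thesis by auto
  qed
  have FT: "card (Cons b ` X) = card X" for b :: bool and X
    by (simp add: card_image)
  have "(A - B) \<union> (B - A) = {v \<in> cube_vertices n. v \<in> (A - B) \<union> (B - A)}"
    using assms by blast
  moreover have "edge_boundary (Suc n) (glue A B) =
    image (Cons False) ` {e \<in> cube_edges n. card (Cons False ` e \<inter> glue A B) = 1}
    \<union> image (Cons True) ` {e \<in> cube_edges n. card (Cons True ` e \<inter> glue A B) = 1}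
    \<union> (\<lambda>v. {False # v, True # v}) ` {v \<in> cube_vertices n. card ({False # v, True # v} \<inter> glue A B) = 1}"
    unfolding edge_boundary_def cube_edges_Suc by blast
  ultimately show ?thesis
    unfolding F T V FT edge_boundary_def by simp
qed

lemma theta_set_glue:
  assumes "A \<subseteq> cube_vertices n" "B \<subseteq> cube_vertices n"
  shows "theta_set (Suc n) (glue A B) =
    theta_set n A + theta_set n B + (card (A - B) + card (B - A))"
proof -
  let ?E = "\<lambda>b X. image (Cons b) ` edge_boundary n X"
  let ?D = "(A - B) \<union> (B - A)"
  let ?V = "(\<lambda>v. {False # v, True # v}) ` ?D"
  have fin: "finite (edge_boundary n X)" for X
    by (simp add: edge_boundary_def finite_cube_edges)
  have finAB: "finite A" "finite B"
    using assms finite_cube_vertices finite_subset by blast+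
  have "inj (image (Cons b))" for b :: bool
    by (simp add: inj_image_eq_iff inj_def)
  then have cE: "card (?E b X) = card (edge_boundary n X)" for b X
    by (meson card_image inj_on_subset subset_UNIV)
  have "inj_on (\<lambda>v. {False # v, True # v}) ?D"
    by (auto simp: inj_on_def doubleton_eq_iff)
  then have cV: "card ?V = card ?D"
    by (rule card_image)
  have ne: "{} \<notin> edge_boundary n X" for X
    by (simp add: edge_boundary_def empty_notin_cube_edges)
  have d1: "?E False A \<inter> ?E True B = {}"
  proof -
    have False if x: "x \<in> edge_boundary n A" and eq: "Cons False ` x = Cons True ` y" for x y
    proof -
      obtain v where "v \<in> x"
        using ne x by (cases "x = {}") auto
      then have "False # v \<in> Cons True ` y"
        using eq by blast
      then show False by auto
    qed
    then show ?thesis by blast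
  qed
  \<comment> \<open>A matching edge contains both heads, whereas an edge inside a facet shows only
    \<open>b\<close>.\<close>
  have "{False # v, True # v} \<noteq> Cons b ` x" for b v x
    by (cases b) (auto simp: set_eq_iff)
  then have d2: "(?E False A \<union> ?E True B) \<inter> ?V = {}"
    by fastforce
  have "card (edge_boundary (Suc n) (glue A B)) = card (?E False A \<union> ?E True B) + card ?V"
    unfolding edge_boundary_glue[OF assms]
    by (rule card_Un_disjoint) (use d2 fin finAB in auto)
  also have "card (?E False A \<union> ?E True B) = card (?E False A) + card (?E True B)"
    by (rule card_Un_disjoint) (use d1 fin in auto)
  also have "card ?V = card (A - B) + card (B - A)"
    unfolding cV by (rule card_Un_disjoint) (use finAB in auto)
  finally show ?thesis
    unfolding cE by (simp add: theta_set_def edge_boundary_def)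
qed

lemma theta_set_0: "theta_set 0 S = 0"
proof -
  have "cube_edges 0 = {}"
    by (auto simp: cube_edges_def cube_adj_def)
  then show ?thesis
    by (simp add: theta_set_def)
qed

text \<open>Cut \<open>S\<close> into its two facets. The matching edges cut number at least the
  difference of the two sizes, and superadditivity of \<open>digit_sum_upto\<close> pays for the
  rest.\<close>

lemma theta_set_lower_bound:
  "S \<subseteq> cube_vertices n \<Longrightarrow> n * card S \<le> theta_set n S + 2 * digit_sum_upto (card S)"
proof (induction n arbitrary: S)
  case 0
  then show ?case by simp
next
  case (Suc n)
  define A B where "A = slice False S" and "B = slice True S"
  have AB: "A \<subseteq> cube_vertices n" "B \<subseteq> cube_vertices n" and S: "S = glue A B"
    using Suc.prems by (simp_all add: A_def B_def slice_subset glue_slices)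
  have fin: "finite A" "finite B"
    using AB finite_cube_vertices finite_subset by blast+
  let ?f = digit_sum_upto
  \<comment> \<open>With truncated subtraction one of the left sides is 0, so together they give the
    absolute difference, that is, the sum of the sizes minus twice their minimum.\<close>
  have "card A - card B \<le> card (A - B)" "card B - card A \<le> card (B - A)"
    using fin by (simp_all add: diff_card_le_card_Diff)
  moreover have "?f (card A) + ?f (card B) + min (card A) (card B) \<le> ?f (card A + card B)"
    using digit_sum_upto_superadditive[of "card A" "card B"]
      digit_sum_upto_superadditive[of "card B" "card A"]
    by (cases "card A \<le> card B") (simp_all add: add.commute)
  ultimately have "card A + card B + 2 * (?f (card A) + ?f (card B))
      \<le> card (A - B) + card (B - A) + 2 * ?f (card A + card B)"
    by (cases "card A \<le> card B") simp_all
  then show ?case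
    using Suc.IH[OF AB(1)] Suc.IH[OF AB(2)]
    by (simp add: S theta_set_glue AB card_glue fin algebra_simps)
qed

text \<open>The first \<open>k\<close> vertices in binary order, the head of a list being the least significant digit.\<close>

fun initial_segment :: "nat \<Rightarrow> nat \<Rightarrow> bool list set" where
  "initial_segment 0 k = (if k = 0 then {} else {[]})"
| "initial_segment (Suc n) k = glue (initial_segment n (Suc k div 2)) (initial_segment n (k div 2))"

lemma initial_segment_subset: "initial_segment n k \<subseteq> cube_vertices n"
  by (induction n arbitrary: k) (auto simp: glue_def cube_vertices_def subset_iff)

lemma finite_initial_segment: "finite (initial_segment n k)"
  using initial_segment_subset finite_cube_vertices by (rule finite_subset)

text \<open>Nested halves cut as few matching edges as their sizes permit, which is what makes
  initial segments optimal.\<close>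

lemma initial_segment_mono: "i \<le> j \<Longrightarrow> initial_segment n i \<subseteq> initial_segment n j"
proof (induction n arbitrary: i j)
  case (Suc n)
  have "initial_segment n (Suc i div 2) \<subseteq> initial_segment n (Suc j div 2)"
    "initial_segment n (i div 2) \<subseteq> initial_segment n (j div 2)"
    using Suc by (simp_all add: div_le_mono)
  then show ?case
    by (auto simp: glue_def)
qed simp

lemma card_initial_segment: "k \<le> 2 ^ n \<Longrightarrow> card (initial_segment n k) = k"
proof (induction n arbitrary: k)
  case (Suc n)
  then have "Suc k div 2 \<le> 2 ^ n" "k div 2 \<le> 2 ^ n"
    by simp_all
  then have "card (initial_segment (Suc n) k) = Suc k div 2 + k div 2"
    using Suc.IH by (simp add: card_glue finite_initial_segment)
  then show ?case by presburger
qed auto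

text \<open>Equality holds at every stage of the facet induction: the halves are nested, so exactly
  \<open>p - q\<close> matching edges are cut, and \<open>digit_sum_upto_halves\<close> is an
  identity.\<close>

lemma theta_set_initial_segment:
  "k \<le> 2 ^ n \<Longrightarrow> theta_set n (initial_segment n k) + 2 * digit_sum_upto k = n * k"
proof (induction n arbitrary: k)
  case 0
  then have "k = 0 \<or> k = Suc 0" by auto
  then show ?case
    by (auto simp: theta_set_0 digit_sum_upto_Suc)
next
  case (Suc n)
  let ?f = digit_sum_upto
  define p q where "p = Suc k div 2" and "q = k div 2"
  let ?P = "initial_segment n p" and ?Q = "initial_segment n q"
  have pq: "p \<le> 2 ^ n" "q \<le> 2 ^ n" "q \<le> p" and k: "k = p + q"
    using Suc.prems by (auto simp: p_def q_def)
  have sub: "?Q \<subseteq> ?P"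
    using pq by (simp add: initial_segment_mono)
  then have "card (?P - ?Q) = p - q" "card (?Q - ?P) = 0"
    using pq by (simp_all add: card_Diff_subset finite_initial_segment card_initial_segment
        Diff_eq_empty_iff[THEN iffD2])
  then have "theta_set (Suc n) (initial_segment (Suc n) k)
      = theta_set n ?P + theta_set n ?Q + (p - q)"
    by (simp add: theta_set_glue initial_segment_subset flip: p_def q_def)
  moreover have "?f k = ?f p + ?f q + q"
    unfolding p_def q_def by (rule digit_sum_upto_halves)
  moreover have "theta_set n ?P + 2 * ?f p = n * p" "theta_set n ?Q + 2 * ?f q = n * q"
    using Suc.IH pq by simp_all
  ultimately show ?case
    using pq(3) k by (simp add: algebra_simps)
qed

section \<open>The exact isoperimetric value and the final inequality\<close>

text \<open>The initial segment attains the lower bound valid for all sets of its size. The additive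
  form avoids truncated subtraction.\<close>

lemma theta_add_digit_sum_upto:
  assumes "k \<le> 2 ^ n"
  shows "theta n k + 2 * digit_sum_upto k = n * k"
proof -
  let ?T = "{theta_set n S | S. S \<subseteq> cube_vertices n \<and> card S = k}"
  have "theta n k = theta_set n (initial_segment n k)"
    unfolding theta_def
  proof (rule Min_eqI[OF finite_theta_candidates])
    show "theta_set n (initial_segment n k) \<in> ?T"
      using assms initial_segment_subset card_initial_segment by blast
  next
    fix t assume "t \<in> ?T"
    then have "n * k \<le> t + 2 * digit_sum_upto k"
      using theta_set_lower_bound by blast
    then show "theta_set n (initial_segment n k) \<le> t"
      using theta_set_initial_segment[OF assms] by linarith
  qed
  then show ?thesis
    using theta_set_initial_segment[OF assms] by simp
qed

theorem theorem4p2: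
  fixes n k :: nat
  assumes "n \<ge> 1" and "k \<le> 2 ^ (n - 1)"
  shows "(2 * k + 1) * theta n k \<ge> 2 * (\<Sum>i=0..k. theta n i)"
proof -
  let ?f = digit_sum_upto
  have "(2::nat) ^ (n - 1) \<le> 2 ^ n"
    by (rule power_increasing) simp_all
  then have eq: "theta n i + 2 * ?f i = n * i" if "i \<le> k" for i
    using that assms(2) by (intro theta_add_digit_sum_upto) linarith
  have "(\<Sum>i=0..k. theta n i) + 2 * (\<Sum>i=0..k. ?f i) = (\<Sum>i=0..k. theta n i + 2 * ?f i)"
    by (simp add: sum.distrib sum_distrib_left)
  also have "\<dots> = (\<Sum>i=0..k. n * i)"
    by (rule sum.cong) (simp_all add: eq)
  finally have "2 * (\<Sum>i=0..k. theta n i) + 4 * (\<Sum>i=0..k. ?f i) = n * (2 * (\<Sum>i=0..k. i))"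
    by (simp flip: sum_distrib_left)
  also have "2 * (\<Sum>i=0..k. i) = k * k + k"
    by (induction k) simp_all
  finally have "2 * (\<Sum>i=0..k. theta n i) + 4 * (\<Sum>i=0..k. ?f i) = n * (k * k) + n * k"
    by (simp add: algebra_simps)
  \<comment> \<open>Compared with the preceding identity and summed by parts, the two sides of the
    goal differ by \<open>n * (k * k) - 2 * weighted_digit_sum_upto k\<close>.\<close>
  moreover have "(2 * k + 1) * theta n k + 2 * ((2 * k + 1) * ?f k) = 2 * (n * (k * k)) + n * k"
  proof -
    have "(2 * k + 1) * theta n k + 2 * ((2 * k + 1) * ?f k) = (2 * k + 1) * (theta n k + 2 * ?f k)"
      by (simp add: algebra_simps)
    then show ?thesis
      unfolding eq[OF order_refl] by (simp add: algebra_simps)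
  qed
  \<comment> \<open>The bound \<open>k \<le> 2 ^ (n - 1)\<close> enters here: it gives the factor
    \<open>Suc (n - 1) = n\<close>, where \<open>k \<le> 2 ^ n\<close> would only give
    \<open>n + 1\<close>.\<close>
  moreover have "2 * weighted_digit_sum_upto k \<le> n * (k * k)"
    using weighted_digit_sum_upto_le[OF assms(2)] assms(1) by simp
  ultimately show ?thesis
    using weighted_digit_sum_upto_summation_by_parts[of k] by linarith
qed

end
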